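(* Let $(L,[\cdot,\cdot])$ be a Lie algebra with linear basis $\{x_i\}_{i\in I}$ and let $\diamond:L\otimes L\to L$ be a bilinear operation. Write $$x_i\diamond x_j=\sum_{m\in I}\gamma_{i,j}^m x_m,\qquad[x_i,x_j]=\sum_{m\in I}\delta_{i,j}^m x_m$$ (finite sums, real coefficients) and $\gamma_{[i,j]}^m:=\gamma_{i,j}^m-\gamma_{j,i}^m$. Then: 1. $\mathbf{T}^{\diamond,[\cdot,\cdot]}=0$ if and only if for all $(i,j,m)\in I^3$: $\ \gamma_{[i,j]}^m=\delta_{i,j}^m$. 2. $\diamond\,\mathbf{T}^{\diamond,[\cdot,\cdot]}=0$ if and only if for all $(i,j,k,m)\in I^4$: $$\sum_{l\in I}\Big(\gamma_{i,l}^m\big(\gamma_{[j,k]}^l-\delta_{j,k}^l\big)-\gamma_{i,j}^l\big(\gamma_{[l,k]}^m-\delta_{l,k}^m\big)-\big(\gamma_{[j,l]}^m-\delta_{j,l}^m\big)\gamma_{i,k}^l\Big)=0.$$ 3. $\mathbf{R}^{\diamond,[\cdot,\cdot]}=0$ if and only if for all $(i,j,k,m)\in I^4$: $$\sum_{l\in I}\Big(\gamma_{i,l}^m\gamma_{j,k}^l-\gamma_{j,l}^m\gamma_{i,k}^l-\delta_{i,j}^l\gamma_{l,k}^m\Big)=0.$$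
   Context: Vector spaces are over $\mathbb{R}$. $[x,y]_\diamond:=x\diamond y-y\diamond x$. The torsion and curvature of $\diamond$ on $(L,[\cdot,\cdot])$ are $\mathbf{T}^{\diamond,[\cdot,\cdot]}(x,y):=[x,y]_\diamond-[x,y]$ and $\mathbf{R}^{\diamond,[\cdot,\cdot]}(x,y,z):=x\diamond(y\diamond z)-y\diamond(x\diamond z)-[x,y]\diamond z$. The covariant derivative of the torsion is $(x\diamond\mathbf{T})(y,z):=x\diamond(\mathbf{T}(y,z))-\mathbf{T}(x\diamond y,z)-\mathbf{T}(y,x\diamond z)$, and $\diamond\,\mathbf{T}=0$ means this vanishes for all $x,y,z\in L$. *)

theory Defs
  imports "HOL-Analysis.Analysis"
begin

definition lie_bracket :: "('a::real_vector \<Rightarrow> 'a \<Rightarrow> 'a) \<Rightarrow> bool" where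
  "lie_bracket br \<longleftrightarrow> bilinear br \<and> (\<forall>x. br x x = 0) \<and>
     (\<forall>x y z. br x (br y z) + br y (br z x) + br z (br x y) = 0)"

definition commutator :: "('a::real_vector \<Rightarrow> 'a \<Rightarrow> 'a) \<Rightarrow> 'a \<Rightarrow> 'a \<Rightarrow> 'a" where
  "commutator d x y = d x y - d y x"

definition torsion ::
  "('a::real_vector \<Rightarrow> 'a \<Rightarrow> 'a) \<Rightarrow> ('a \<Rightarrow> 'a \<Rightarrow> 'a) \<Rightarrow> 'a \<Rightarrow> 'a \<Rightarrow> 'a" where
  "torsion d br x y = commutator d x y - br x y"

definition curvature ::
  "('a::real_vector \<Rightarrow> 'a \<Rightarrow> 'a) \<Rightarrow> ('a \<Rightarrow> 'a \<Rightarrow> 'a) \<Rightarrow> 'a \<Rightarrow> 'a \<Rightarrow> 'a \<Rightarrow> 'a" where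
  "curvature d br x y z = d x (d y z) - d y (d x z) - d (br x y) z"

definition covariant_derivative ::
  "('a::real_vector \<Rightarrow> 'a \<Rightarrow> 'a) \<Rightarrow> ('a \<Rightarrow> 'a \<Rightarrow> 'a) \<Rightarrow> 'a \<Rightarrow> 'a \<Rightarrow> 'a \<Rightarrow> 'a" where
  "covariant_derivative d T x y z = d x (T y z) - T (d x y) z - T y (d x z)"

definition linear_basis :: "('i \<Rightarrow> 'a::real_vector) \<Rightarrow> 'i set \<Rightarrow> bool" where
  "linear_basis b I \<longleftrightarrow> inj_on b I \<and> independent (b ` I) \<and> span (b ` I) = UNIV"

text \<open>
  Here \<open>c i j m\<close> is the coefficient of \<open>b m\<close> in \<open>h (b i) (b j)\<close>; values of \<open>c\<close> at indices
  outside \<open>I\<close> are irrelevant. The index set may be infinite, so sums over it are taken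
  with \<open>sum'\<close>, which adds up the finitely many nonzero terms.
\<close>

definition structure_constants ::
  "('i \<Rightarrow> 'a::real_vector) \<Rightarrow> 'i set \<Rightarrow> ('a \<Rightarrow> 'a \<Rightarrow> 'a) \<Rightarrow> ('i \<Rightarrow> 'i \<Rightarrow> 'i \<Rightarrow> real) \<Rightarrow> bool" where
  "structure_constants b I h c \<longleftrightarrow>
     (\<forall>i\<in>I. \<forall>j\<in>I. finite {m \<in> I. c i j m \<noteq> 0} \<and>
        h (b i) (b j) = sum' (\<lambda>m. c i j m *\<^sub>R b m) I)"

definition antisym_coeff :: "('i \<Rightarrow> 'i \<Rightarrow> 'i \<Rightarrow> real) \<Rightarrow> 'i \<Rightarrow> 'i \<Rightarrow> 'i \<Rightarrow> real" where
  "antisym_coeff c i j m = c i j m - c j i m"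

end

theory Submission
  imports Defs
begin

text \<open>
  A linear map out of a space with basis \<open>b\<close> vanishes iff it vanishes on the basis, so each of
  the multilinear maps torsion, covariant derivative of the torsion and curvature vanishes
  iff all coordinates of its values on basis vectors do. Expanding the nested products with the
  structure constants of the two operations turns these coordinates into the stated sums.
\<close>

text \<open>\<open>representation\<close> attaches coefficients to basis vectors; here they are
  attached to the indices in \<open>I\<close>, as in \<open>structure_constants\<close>. Injectivity
  of \<open>b\<close> on \<open>I\<close> keeps distinct indices apart.\<close>

definition coordinate :: "('i \<Rightarrow> 'a::real_vector) \<Rightarrow> 'i set \<Rightarrow> 'i \<Rightarrow> 'a \<Rightarrow> real" where
  "coordinate b I m x = representation (b ` I) x (b m)"

lemma linear_coordinate:
  assumes "linear_basis b I"
  shows "linear (coordinate b I m)"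
  using assms unfolding coordinate_def linear_basis_def
  by (intro linearI) (auto simp: real_vector.representation_add real_vector.representation_scale)

lemma coordinate_basis:
  assumes "linear_basis b I" "l \<in> I" "m \<in> I"
  shows "coordinate b I m (b l) = (if l = m then 1 else 0)"
  using assms unfolding coordinate_def linear_basis_def
  by (auto simp: real_vector.representation_basis inj_on_eq_iff)

lemma zero_iff_coordinate_zero:
  assumes "linear_basis b I"
  shows "x = 0 \<longleftrightarrow> (\<forall>m\<in>I. coordinate b I m x = 0)"
proof
  assume "x = 0"
  then show "\<forall>m\<in>I. coordinate b I m x = 0"
    using linear_coordinate[OF assms] by (simp add: linear_0)
next
  assume zero: "\<forall>m\<in>I. coordinate b I m x = 0"
  have "(\<Sum>v | representation (b ` I) x v \<noteq> 0. representation (b ` I) x v *\<^sub>R v) = x"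
    using assms unfolding linear_basis_def
    by (intro real_vector.sum_nonzero_representation_eq) auto
  moreover have "representation (b ` I) x v = 0" for v
    using zero real_vector.representation_ne_zero[of "b ` I" x v]
    unfolding coordinate_def by blast
  ultimately show "x = 0" by simp
qed

lemma linear_zero_on_basis:
  assumes "linear_basis b I" "linear f" "\<And>i. i \<in> I \<Longrightarrow> f (b i) = 0"
  shows "f x = 0"
  using linear_eq_0_on_span[of f "b ` I" x] assms unfolding linear_basis_def by auto

text \<open>Arguments are freed one at a time: with a basis vector in the first slot, linearity in
  the second gives zero there, and linearity in the first slot finishes. The trilinear case repeats
  this one level up.\<close>

lemma bilinear_zero_on_basis:
  assumes basis: "linear_basis b I"
    and "\<And>x. linear (\<lambda>y. f x y)" "\<And>y. linear (\<lambda>x. f x y)"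
    and "\<And>i j. i \<in> I \<Longrightarrow> j \<in> I \<Longrightarrow> f (b i) (b j) = 0"
  shows "f x y = 0"
proof -
  have zero: "f (b i) y = 0" if "i \<in> I" for i
    by (rule linear_zero_on_basis[OF basis, of "f (b i)"]) (simp_all add: assms(2-4) that)
  show ?thesis
    by (rule linear_zero_on_basis[OF basis, of "\<lambda>x. f x y"]) (simp_all add: assms(3) zero)
qed

lemma trilinear_zero_on_basis:
  assumes basis: "linear_basis b I"
    and "\<And>x y. linear (\<lambda>z. f x y z)" "\<And>x z. linear (\<lambda>y. f x y z)" "\<And>y z. linear (\<lambda>x. f x y z)"
    and "\<And>i j k. i \<in> I \<Longrightarrow> j \<in> I \<Longrightarrow> k \<in> I \<Longrightarrow> f (b i) (b j) (b k) = 0"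
  shows "f x y z = 0"
proof -
  have zero: "f (b i) y z = 0" if "i \<in> I" for i
    by (rule bilinear_zero_on_basis[OF basis, of "f (b i)"]) (simp_all add: assms(2-5) that)
  show ?thesis
    by (rule linear_zero_on_basis[OF basis, of "\<lambda>x. f x y z"]) (simp_all add: assms(4) zero)
qed

text \<open>An infinite support makes \<open>sum'\<close> zero by default, so splitting needs finite
  supports. Finiteness for the difference is also concluded so that the rule can be
  iterated.\<close>

lemma sum'_diff:
  fixes f g :: "'i \<Rightarrow> 'b::ab_group_add"
  assumes "finite {l \<in> I. f l \<noteq> 0}" "finite {l \<in> I. g l \<noteq> 0}"
  shows "finite {l \<in> I. f l - g l \<noteq> 0}"
    and "sum' (\<lambda>l. f l - g l) I = sum' f I - sum' g I"
proof -
  show fin: "finite {l \<in> I. f l - g l \<noteq> 0}"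
    by (rule finite_subset[OF _ finite_UnI[OF assms]]) auto
  have "sum' (\<lambda>l. (f l - g l) + g l) I = sum' (\<lambda>l. f l - g l) I + sum' g I"
    by (rule sum.distrib') (use fin assms in auto)
  then show "sum' (\<lambda>l. f l - g l) I = sum' f I - sum' g I"
    by (simp add: algebra_simps)
qed

text \<open>The index set on the right depends on the coefficients alone, not on \<open>v\<close>.
  It therefore stays the same when a linear map is applied to the vectors, even if the map kills
  some of them.\<close>

lemma sum'_scaleR_eq_sum:
  fixes v :: "'i \<Rightarrow> 'a::real_vector"
  assumes "finite {l \<in> I. c l \<noteq> 0}"
  shows "sum' (\<lambda>l. c l *\<^sub>R v l) I = (\<Sum>l | l \<in> I \<and> c l \<noteq> 0. c l *\<^sub>R v l)"
proof -
  have sub: "{l \<in> I. c l *\<^sub>R v l \<noteq> 0} \<subseteq> {l \<in> I. c l \<noteq> 0}" by auto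
  show ?thesis
    unfolding sum.G_def if_P[OF finite_subset[OF sub assms]]
    by (rule sum.mono_neutral_left[OF assms sub]) auto
qed

lemma linear_sum':
  assumes "linear f" "finite {l \<in> I. c l \<noteq> 0}"
  shows "f (sum' (\<lambda>l. c l *\<^sub>R v l) I) = sum' (\<lambda>l. c l *\<^sub>R f (v l)) I"
  using assms by (simp add: sum'_scaleR_eq_sum linear_sum linear_scale)

lemma structure_constants_finite:
  "structure_constants b I h c \<Longrightarrow> i \<in> I \<Longrightarrow> j \<in> I \<Longrightarrow> finite {m \<in> I. c i j m \<noteq> 0}"
  unfolding structure_constants_def by blast

lemma linear_structure_constants:
  fixes f :: "'a::real_vector \<Rightarrow> real"
  assumes "structure_constants b I h c" "i \<in> I" "j \<in> I" "linear f"
  shows "f (h (b i) (b j)) = sum' (\<lambda>l. c i j l * f (b l)) I"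
proof -
  have "h (b i) (b j) = sum' (\<lambda>l. c i j l *\<^sub>R b l) I"
    using assms(1-3) unfolding structure_constants_def by blast
  then show ?thesis
    using linear_sum'[OF assms(4) structure_constants_finite[OF assms(1-3)], of b] by simp
qed

lemma coordinate_structure_constants:
  assumes "linear_basis b I" "structure_constants b I h c" "i \<in> I" "j \<in> I" "m \<in> I"
  shows "coordinate b I m (h (b i) (b j)) = c i j m"
proof -
  have "coordinate b I m (h (b i) (b j)) = sum' (\<lambda>l. c i j l * coordinate b I m (b l)) I"
    using assms linear_coordinate by (intro linear_structure_constants) auto
  \<comment> \<open>The coordinates of basis vectors form a Kronecker delta, so only the term at
    \<open>m\<close> survives.\<close>
  also have "\<dots> = sum' (\<lambda>l. if l = m then c i j m else 0) I"
    using assms by (intro sum.cong') (auto simp: coordinate_basis)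
  also have "\<dots> = sum' (\<lambda>l. if l = m then c i j m else 0) {m}"
    using assms by (intro sum.mono_neutral_right') auto
  finally show ?thesis by simp
qed

text \<open>The functional sending \<open>x\<close> to the \<open>m\<close>-th coordinate of
  \<open>g (b i) x\<close> takes the value \<open>a i l m\<close> at \<open>b l\<close>; it is
  evaluated on the expansion of the inner product. Finiteness comes from the inner factor
  \<open>c j k l\<close>, since \<open>a i l m\<close> may be nonzero for infinitely many
  \<open>l\<close>.\<close>

lemma coordinate_right_product:
  assumes "linear_basis b I" "bilinear g" "structure_constants b I g a"
    and "structure_constants b I h c" "i \<in> I" "j \<in> I" "k \<in> I" "m \<in> I"
  shows "finite {l \<in> I. a i l m * c j k l \<noteq> 0}"
    and "coordinate b I m (g (b i) (h (b j) (b k))) = sum' (\<lambda>l. a i l m * c j k l) I"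
proof -
  show "finite {l \<in> I. a i l m * c j k l \<noteq> 0}"
    by (rule finite_subset[OF _ structure_constants_finite[OF assms(4,6,7)]]) auto
  have "linear (\<lambda>x. g (b i) x)" using assms(2) unfolding bilinear_def by blast
  from linear_compose[OF this linear_coordinate[OF assms(1)]]
  have "linear (\<lambda>x. coordinate b I m (g (b i) x))" by (simp add: o_def)
  from linear_structure_constants[OF assms(4,6,7) this]
  show "coordinate b I m (g (b i) (h (b j) (b k))) = sum' (\<lambda>l. a i l m * c j k l) I"
    using assms by (auto simp: coordinate_structure_constants mult.commute intro!: sum.cong')
qed

lemma coordinate_left_product:
  assumes "linear_basis b I" "bilinear g" "structure_constants b I g a"
    and "structure_constants b I h c" "i \<in> I" "j \<in> I" "k \<in> I" "m \<in> I"
  shows "finite {l \<in> I. c i j l * a l k m \<noteq> 0}"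
    and "coordinate b I m (g (h (b i) (b j)) (b k)) = sum' (\<lambda>l. c i j l * a l k m) I"
proof -
  show "finite {l \<in> I. c i j l * a l k m \<noteq> 0}"
    by (rule finite_subset[OF _ structure_constants_finite[OF assms(4,5,6)]]) auto
  have "linear (\<lambda>x. g x (b k))" using assms(2) unfolding bilinear_def by blast
  from linear_compose[OF this linear_coordinate[OF assms(1)]]
  have "linear (\<lambda>x. coordinate b I m (g x (b k)))" by (simp add: o_def)
  from linear_structure_constants[OF assms(4,5,6) this]
  show "coordinate b I m (g (h (b i) (b j)) (b k)) = sum' (\<lambda>l. c i j l * a l k m) I"
    using assms by (auto simp: coordinate_structure_constants intro!: sum.cong')
qed

lemma structure_constants_diff:
  assumes "structure_constants b I g a" "structure_constants b I h c"
  shows "structure_constants b I (\<lambda>x y. g x y - h x y) (\<lambda>i j m. a i j m - c i j m)"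
  unfolding structure_constants_def
proof (intro ballI)
  fix i j assume ij: "i \<in> I" "j \<in> I"
  note fin = structure_constants_finite[OF assms(1) ij] structure_constants_finite[OF assms(2) ij]
  \<comment> \<open>\<open>sum'\<close> looks at the support of the vector-valued terms, which lies
    inside that of the scalar coefficients.\<close>
  have "finite {m \<in> I. a i j m *\<^sub>R b m \<noteq> 0}" "finite {m \<in> I. c i j m *\<^sub>R b m \<noteq> 0}"
    by (rule finite_subset[OF _ fin(1)] finite_subset[OF _ fin(2)]; auto)+
  note diff = sum'_diff(2)[OF this]
  show "finite {m \<in> I. a i j m - c i j m \<noteq> 0} \<and>
      g (b i) (b j) - h (b i) (b j) = sum' (\<lambda>m. (a i j m - c i j m) *\<^sub>R b m) I"
    using sum'_diff(1)[OF fin] diff assms ij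
    by (simp add: structure_constants_def scaleR_diff_left)
qed

text \<open>Treating the torsion as a product with its own constants lets the nested-product lemmas
  apply to it directly.\<close>

lemma structure_constants_torsion:
  assumes "structure_constants b I d \<gamma>" "structure_constants b I br \<delta>"
  shows "structure_constants b I (torsion d br) (\<lambda>i j m. antisym_coeff \<gamma> i j m - \<delta> i j m)"
proof -
  have swap: "structure_constants b I (\<lambda>x y. d y x) (\<lambda>i j. \<gamma> j i)"
    using assms(1) unfolding structure_constants_def by blast
  show ?thesis
    using structure_constants_diff[OF structure_constants_diff[OF assms(1) swap] assms(2)]
    by (simp add: torsion_def[abs_def] commutator_def antisym_coeff_def)
qed

lemma bilinear_torsion:
  assumes "bilinear d" "bilinear br"
  shows "bilinear (torsion d br)"
  using assms unfolding bilinear_def torsion_def commutator_def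
  by (auto intro!: linear_compose_sub)

theorem proposition5p1:
  fixes br d :: "'a::real_vector \<Rightarrow> 'a \<Rightarrow> 'a"
    and b :: "'i \<Rightarrow> 'a" and I :: "'i set"
    and \<gamma> \<delta> :: "'i \<Rightarrow> 'i \<Rightarrow> 'i \<Rightarrow> real"
  assumes "lie_bracket br"
    and "bilinear d"
    and "linear_basis b I"
    and "structure_constants b I d \<gamma>"
    and "structure_constants b I br \<delta>"
  shows "((\<forall>x y. torsion d br x y = 0) \<longleftrightarrow>
            (\<forall>i\<in>I. \<forall>j\<in>I. \<forall>m\<in>I. antisym_coeff \<gamma> i j m = \<delta> i j m)) \<and>
         ((\<forall>x y z. covariant_derivative d (torsion d br) x y z = 0) \<longleftrightarrow>
            (\<forall>i\<in>I. \<forall>j\<in>I. \<forall>k\<in>I. \<forall>m\<in>I.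
               sum' (\<lambda>l. \<gamma> i l m * (antisym_coeff \<gamma> j k l - \<delta> j k l)
                       - \<gamma> i j l * (antisym_coeff \<gamma> l k m - \<delta> l k m)
                       - (antisym_coeff \<gamma> j l m - \<delta> j l m) * \<gamma> i k l) I = 0)) \<and>
         ((\<forall>x y z. curvature d br x y z = 0) \<longleftrightarrow>
            (\<forall>i\<in>I. \<forall>j\<in>I. \<forall>k\<in>I. \<forall>m\<in>I.
               sum' (\<lambda>l. \<gamma> i l m * \<gamma> j k l - \<gamma> j l m * \<gamma> i k l - \<delta> i j l * \<gamma> l k m) I = 0))"
proof (intro conjI)
  let ?T = "torsion d br" and ?\<tau> = "\<lambda>i j m. antisym_coeff \<gamma> i j m - \<delta> i j m"
  note basis = assms(3) and d = assms(2)
  have br: "bilinear br" using assms(1) unfolding lie_bracket_def by blast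
  note T = bilinear_torsion[OF d br] and \<tau> = structure_constants_torsion[OF assms(4,5)]
  have lin: "linear (\<lambda>x. h x y)" "linear (\<lambda>x. h y x)"
    if "bilinear h" for h :: "'a \<Rightarrow> 'a \<Rightarrow> 'a" and y
    using that unfolding bilinear_def by auto
  have comp: "linear (\<lambda>x. h (f x) y)" "linear (\<lambda>x. h y (f x))"
    if "bilinear h" "linear f" for h :: "'a \<Rightarrow> 'a \<Rightarrow> 'a" and f :: "'a \<Rightarrow> 'a" and y
    using linear_compose[OF that(2) lin(1)[OF that(1)]] linear_compose[OF that(2) lin(2)[OF that(1)]]
    by (simp_all add: o_def)
  \<comment> \<open>These rules establish linearity in one variable of a nested expression: they
    split differences, then peel off products from the outside until the identity remains.\<close>
  note lins = linear_compose_sub comp[OF d] comp[OF br] comp[OF T] linear_ident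
  note coord_diff = linear_diff[OF linear_coordinate[OF basis]]

  have "(\<forall>x y. ?T x y = 0) \<longleftrightarrow> (\<forall>i\<in>I. \<forall>j\<in>I. ?T (b i) (b j) = 0)"
    using bilinear_zero_on_basis[OF basis, of ?T] lin[OF T] by blast
  also have "\<dots> \<longleftrightarrow> (\<forall>i\<in>I. \<forall>j\<in>I. \<forall>m\<in>I. ?\<tau> i j m = 0)"
    by (simp add: zero_iff_coordinate_zero[OF basis] coordinate_structure_constants[OF basis \<tau>])
  finally show "(\<forall>x y. ?T x y = 0) \<longleftrightarrow>
      (\<forall>i\<in>I. \<forall>j\<in>I. \<forall>m\<in>I. antisym_coeff \<gamma> i j m = \<delta> i j m)"
    by simp

  let ?D = "covariant_derivative d ?T"
  have coord_D: "coordinate b I m (?D (b i) (b j) (b k)) =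
      sum' (\<lambda>l. \<gamma> i l m * ?\<tau> j k l - \<gamma> i j l * ?\<tau> l k m - ?\<tau> j l m * \<gamma> i k l) I"
    if "i \<in> I" "j \<in> I" "k \<in> I" "m \<in> I" for i j k m
  proof -
    \<comment> \<open>One expansion for each term of the covariant derivative. In the last one the
      outer factor is \<open>b j\<close> and the inner product is \<open>d (b i) (b k)\<close>, so
      \<open>i\<close> and \<open>j\<close> trade places.\<close>
    note p1 = coordinate_right_product[OF basis d assms(4) \<tau> that]
    note p2 = coordinate_left_product[OF basis T \<tau> assms(4) that]
    note p3 = coordinate_right_product[OF basis T \<tau> assms(4) that(2,1,3,4)]
    show ?thesis
      \<comment> \<open>The single sum on the right splits into three; the finite support of the
        first difference licenses the outer split.\<close>
      unfolding covariant_derivative_def coord_diff p1 p2 p3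
        sum'_diff(2)[OF sum'_diff(1)[OF p1(1) p2(1)] p3(1)] sum'_diff(2)[OF p1(1) p2(1)] ..
  qed
  have "(\<forall>x y z. ?D x y z = 0) \<longleftrightarrow> (\<forall>i\<in>I. \<forall>j\<in>I. \<forall>k\<in>I. ?D (b i) (b j) (b k) = 0)"
  proof (intro iffI allI)
    fix x y z assume zero: "\<forall>i\<in>I. \<forall>j\<in>I. \<forall>k\<in>I. ?D (b i) (b j) (b k) = 0"
    show "?D x y z = 0"
    proof (rule trilinear_zero_on_basis[OF basis, of ?D])
      show "linear (\<lambda>z. ?D x y z)" "linear (\<lambda>y. ?D x y z)" "linear (\<lambda>x. ?D x y z)" for x y z
        unfolding covariant_derivative_def by (intro lins)+
    qed (use zero in blast)
  qed auto
  then show "(\<forall>x y z. ?D x y z = 0) \<longleftrightarrow> (\<forall>i\<in>I. \<forall>j\<in>I. \<forall>k\<in>I. \<forall>m\<in>I.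
      sum' (\<lambda>l. \<gamma> i l m * ?\<tau> j k l - \<gamma> i j l * ?\<tau> l k m - ?\<tau> j l m * \<gamma> i k l) I = 0)"
    by (simp add: zero_iff_coordinate_zero[OF basis] coord_D)

  let ?R = "curvature d br"
  have coord_R: "coordinate b I m (?R (b i) (b j) (b k)) =
      sum' (\<lambda>l. \<gamma> i l m * \<gamma> j k l - \<gamma> j l m * \<gamma> i k l - \<delta> i j l * \<gamma> l k m) I"
    if "i \<in> I" "j \<in> I" "k \<in> I" "m \<in> I" for i j k m
  proof -
    \<comment> \<open>The first two terms nest \<open>d\<close> in itself, with \<open>i\<close> and
      \<open>j\<close> exchanged in the second; in the third the bracket is the inner product, which
      brings in \<delta>.\<close>
    note p1 = coordinate_right_product[OF basis d assms(4,4) that]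
    note p2 = coordinate_right_product[OF basis d assms(4,4) that(2,1,3,4)]
    note p3 = coordinate_left_product[OF basis d assms(4,5) that]
    show ?thesis
      unfolding curvature_def coord_diff p1 p2 p3
        sum'_diff(2)[OF sum'_diff(1)[OF p1(1) p2(1)] p3(1)] sum'_diff(2)[OF p1(1) p2(1)] ..
  qed
  have "(\<forall>x y z. ?R x y z = 0) \<longleftrightarrow> (\<forall>i\<in>I. \<forall>j\<in>I. \<forall>k\<in>I. ?R (b i) (b j) (b k) = 0)"
  proof (intro iffI allI)
    fix x y z assume zero: "\<forall>i\<in>I. \<forall>j\<in>I. \<forall>k\<in>I. ?R (b i) (b j) (b k) = 0"
    show "?R x y z = 0"
    proof (rule trilinear_zero_on_basis[OF basis, of ?R])
      show "linear (\<lambda>z. ?R x y z)" "linear (\<lambda>y. ?R x y z)" "linear (\<lambda>x. ?R x y z)" for x y z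
        unfolding curvature_def by (intro lins)+
    qed (use zero in blast)
  qed auto
  then show "(\<forall>x y z. ?R x y z = 0) \<longleftrightarrow> (\<forall>i\<in>I. \<forall>j\<in>I. \<forall>k\<in>I. \<forall>m\<in>I.
      sum' (\<lambda>l. \<gamma> i l m * \<gamma> j k l - \<gamma> j l m * \<gamma> i k l - \<delta> i j l * \<gamma> l k m) I = 0)"
    by (simp add: zero_iff_coordinate_zero[OF basis] coord_R)
qed

end
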